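(* Let $M=(S_1,r_1)$ be a matroid, let $U_{2,3}=(S_2,r_2)$ be the rank-$2$ uniform matroid on three elements, and assume that $M$ and $U_{2,3}$ admit a tensor product $N=(S_1\times S_2,r)$. Let $A,B\subseteq S_1$. Then $N$ has a minor $N'$ such that $N'$ is a one-step extension of $M$ with respect to $A$ and $B$.
   Context: "Matroid" means a matroid on a finite ground set, written as (ground set, rank function). A matroid $N=(S_1\times S_2,r)$ is a tensor product of $M_1=(S_1,r_1)$ and $M_2=(S_2,r_2)$ if $r(X\times Y)=r_1(X)\cdot r_2(Y)$ for all $X\subseteq S_1$, $Y\subseteq S_2$. A minor is a matroid obtained by a sequence of restrictions and contractions. For a matroid $M=(S,r)$ and $A,B\subseteq S$, a one-step extension of $M$ with respect to $A$ and $B$ is a matroid $M'=(S',r')$ with $S\subseteq S'$, $r'(X)=r(X)$ for all $X\subseteq S$, for which there is $Z\subseteq S'$ with $r'(A\cup Z)=r(A)$, $r'(B\cup Z)=r(B)$ and $r'(Z)=r(A)+r(B)-r(A\cup B)$. Since the ground set of a minor of $N$ is a subset of $S_1\times S_2$, the statement is understood after identifying $S_1$ with a copy $S_1\times\{u\}$ for some $u\in S_2$ via $e\mapsto (e,u)$. *)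

theory Defs
  imports Main
begin

text \<open>
  A matroid is a pair of a ground set and a rank function.  Rank functions are total functions on
  \<^typ>\<open>'a set\<close>; only their values on subsets of the ground set are meaningful.
\<close>

type_synonym 'a matroid = "'a set \<times> ('a set \<Rightarrow> nat)"

abbreviation ground :: "'a matroid \<Rightarrow> 'a set" where
  "ground \<equiv> fst"

abbreviation rank :: "'a matroid \<Rightarrow> 'a set \<Rightarrow> nat" where
  "rank \<equiv> snd"

definition is_matroid :: "'a matroid \<Rightarrow> bool" where
  "is_matroid M \<longleftrightarrow>
     finite (ground M) \<and>
     (\<forall>X. X \<subseteq> ground M \<longrightarrow> rank M X \<le> card X) \<and>
     (\<forall>X Y. X \<subseteq> Y \<and> Y \<subseteq> ground M \<longrightarrow> rank M X \<le> rank M Y) \<and>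
     (\<forall>X Y. X \<subseteq> ground M \<and> Y \<subseteq> ground M \<longrightarrow>
        rank M (X \<union> Y) + rank M (X \<inter> Y) \<le> rank M X + rank M Y)"

definition is_uniform :: "nat \<Rightarrow> nat \<Rightarrow> 'a matroid \<Rightarrow> bool" where
  "is_uniform k n M \<longleftrightarrow>
     is_matroid M \<and> card (ground M) = n \<and>
     (\<forall>X. X \<subseteq> ground M \<longrightarrow> rank M X = min (card X) k)"

definition is_tensor_product :: "'a matroid \<Rightarrow> 'b matroid \<Rightarrow> ('a \<times> 'b) matroid \<Rightarrow> bool" where
  "is_tensor_product M1 M2 N \<longleftrightarrow>
     is_matroid M1 \<and> is_matroid M2 \<and> is_matroid N \<and>
     ground N = ground M1 \<times> ground M2 \<and>
     (\<forall>X Y. X \<subseteq> ground M1 \<and> Y \<subseteq> ground M2 \<longrightarrow> rank N (X \<times> Y) = rank M1 X * rank M2 Y)"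

definition restriction :: "'a matroid \<Rightarrow> 'a set \<Rightarrow> 'a matroid" where
  "restriction M X = (X, rank M)"

text \<open>
  The subtraction on \<^typ>\<open>nat\<close> does not truncate when \<open>X\<close> and \<open>Y\<close> lie in the ground
  set, by monotonicity of the rank.
\<close>

definition contraction :: "'a matroid \<Rightarrow> 'a set \<Rightarrow> 'a matroid" where
  "contraction M X = (ground M - X, \<lambda>Y. rank M (Y \<union> X) - rank M X)"

inductive is_minor :: "'a matroid \<Rightarrow> 'a matroid \<Rightarrow> bool" where
  refl: "is_minor N N"
| restrict: "is_minor N' N \<Longrightarrow> X \<subseteq> ground N' \<Longrightarrow> is_minor (restriction N' X) N"
| contract: "is_minor N' N \<Longrightarrow> X \<subseteq> ground N' \<Longrightarrow> is_minor (contraction N' X) N"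

definition is_one_step_extension ::
    "'a matroid \<Rightarrow> 'a matroid \<Rightarrow> 'a set \<Rightarrow> 'a set \<Rightarrow> bool" where
  "is_one_step_extension M' M A B \<longleftrightarrow>
     is_matroid M \<and> is_matroid M' \<and> A \<subseteq> ground M \<and> B \<subseteq> ground M \<and>
     ground M \<subseteq> ground M' \<and> (\<forall>X. X \<subseteq> ground M \<longrightarrow> rank M' X = rank M X) \<and>
     (\<exists>Z. Z \<subseteq> ground M' \<and>
        rank M' (A \<union> Z) = rank M A \<and>
        rank M' (B \<union> Z) = rank M B \<and>
        int (rank M' Z) = int (rank M A) + int (rank M B) - int (rank M (A \<union> B)))"

text \<open>
  The isomorphic copy of \<open>M\<close> under a relabelling \<open>f\<close> of its elements; intended for \<open>f\<close>
  injective on the ground set.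
\<close>

definition relabel :: "('a \<Rightarrow> 'b) \<Rightarrow> 'a matroid \<Rightarrow> 'b matroid" where
  "relabel f M = (f ` ground M, \<lambda>X. rank M {e \<in> ground M. f e \<in> X})"

end

theory Submission imports Defs begin

text \<open>
  Let \<open>S2 = {u, v, w}\<close> and write \<open>X\<^sub>u\<close> for \<open>X \<times> {u}\<close>.  Two facts about a tensor product \<open>N\<close> with
  \<open>U\<^bsub>2,3\<^esub>\<close> carry the argument: two different layers of \<open>N\<close> are skew, so that
  \<open>r (X\<^sub>u \<union> Y\<^sub>v) = r1 X + r1 Y\<close>; and \<open>X\<^sub>u \<union> X\<^sub>v\<close> spans \<open>X\<^sub>w\<close>, because both \<open>X \<times> {u, v}\<close>
  and \<open>X \<times> S2\<close> have rank \<open>2 * r1 X\<close>.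

  The minor is suggested by the linear case, where \<open>N\<close> lives in \<open>V \<oplus> V\<close>, the layers
  being \<open>(x, 0)\<close>, \<open>(0, x)\<close> and \<open>(x, x)\<close>.  Modulo \<open>A\<^sub>v\<close>, a vector \<open>(x, x)\<close> with \<open>x\<close> in the
  span of both \<open>A\<close> and \<open>B\<close> becomes \<open>(x, 0)\<close>, so the span of \<open>B\<^sub>w\<close> contains the intersection of the
  spans of \<open>A\<^sub>u\<close> and \<open>B\<^sub>u\<close>.  The surplus of \<open>B\<^sub>w\<close> is removed by choosing \<open>B' \<subseteq> B\<close> that
  extends a basis of \<open>A\<close> to a basis of \<open>A \<union> B\<close>, and contracting \<open>B'\<^sub>w\<close> as well.

  So contract \<open>C = A\<^sub>v \<union> B'\<^sub>w\<close>, of rank \<open>r1 (A \<union> B)\<close>, and take \<open>Z = (B - B')\<^sub>w\<close>.  Each rank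
  needed is that of a union of layers over three subsets of \<open>S1\<close>; spanning turns it into
  a union of two layers, whose rank is a sum.  In particular \<open>S1\<^sub>u \<union> C\<close> has rank
  \<open>r1 S1 + r C\<close>, so \<open>C\<close> is skew to the copy \<open>S1\<^sub>u\<close> of \<open>M\<close>, which thus survives the contraction.
\<close>

section \<open>Spanning, skewness and relative bases\<close>

lemma rank_le_card:
  "is_matroid M \<Longrightarrow> X \<subseteq> ground M \<Longrightarrow> rank M X \<le> card X"
  by (simp add: is_matroid_def)

lemma rank_mono:
  "is_matroid M \<Longrightarrow> X \<subseteq> Y \<Longrightarrow> Y \<subseteq> ground M \<Longrightarrow> rank M X \<le> rank M Y"
  by (simp add: is_matroid_def)

lemma rank_submodular:
  "is_matroid M \<Longrightarrow> X \<subseteq> ground M \<Longrightarrow> Y \<subseteq> ground M \<Longrightarrow>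
    rank M (X \<union> Y) + rank M (X \<inter> Y) \<le> rank M X + rank M Y"
  by (simp add: is_matroid_def)

lemma rank_Un_le:
  "is_matroid M \<Longrightarrow> X \<subseteq> ground M \<Longrightarrow> Y \<subseteq> ground M \<Longrightarrow>
    rank M (X \<union> Y) \<le> rank M X + rank M Y"
  using rank_submodular[of M X Y] by linarith

lemma rank_Un_spanned:
  assumes "is_matroid M" "Y \<subseteq> W" "W \<subseteq> ground M" "T \<subseteq> ground M"
    and "rank M (Y \<union> T) = rank M Y"
  shows "rank M (W \<union> T) = rank M W"
proof (rule antisym)
  have Y: "Y \<union> T \<subseteq> ground M" using assms by auto
  have "rank M (W \<union> (Y \<union> T)) + rank M (W \<inter> (Y \<union> T)) \<le> rank M W + rank M (Y \<union> T)"
    using rank_submodular assms(1,3) Y by blast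
  moreover have "rank M Y \<le> rank M (W \<inter> (Y \<union> T))"
    by (rule rank_mono) (use assms in auto)
  moreover have "W \<union> (Y \<union> T) = W \<union> T" using assms(2) by blast
  ultimately show "rank M (W \<union> T) \<le> rank M W" using assms(5) by simp
  show "rank M W \<le> rank M (W \<union> T)"
    by (rule rank_mono) (use assms in auto)
qed

lemma skew_subset:
  assumes M: "is_matroid M" and "P \<subseteq> ground M" "Q \<subseteq> ground M"
    and skew: "rank M (P \<union> Q) = rank M P + rank M Q" and "Y \<subseteq> Q"
  shows "rank M (P \<union> Y) = rank M P + rank M Y"
proof (rule antisym)
  have Y: "P \<union> Y \<subseteq> ground M" "Y \<subseteq> ground M" using assms by auto
  have "rank M ((P \<union> Y) \<union> Q) + rank M ((P \<union> Y) \<inter> Q) \<le> rank M (P \<union> Y) + rank M Q"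
    using rank_submodular[OF M Y(1)] assms(3) .
  moreover have "rank M Y \<le> rank M ((P \<union> Y) \<inter> Q)"
    by (rule rank_mono[OF M]) (use assms in auto)
  moreover have "(P \<union> Y) \<union> Q = P \<union> Q" using assms(5) by blast
  ultimately show "rank M P + rank M Y \<le> rank M (P \<union> Y)" using skew by simp
  show "rank M (P \<union> Y) \<le> rank M P + rank M Y"
    using rank_Un_le[OF M assms(2) Y(2)] .
qed

text \<open>
  The set \<open>B'\<close> is a basis of \<open>B - A\<close> in the contraction by \<open>A\<close>.  Adding one element to
  \<open>B\<close> enlarges \<open>B'\<close> only if the element is not already spanned by \<open>A \<union> B\<close>.  The rank of \<open>B'\<close>
  is squeezed between subadditivity of the rank and the cardinality of \<open>B'\<close>.
\<close>

lemma obtain_relative_basis: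
  assumes M: "is_matroid M" and "A \<subseteq> ground M" "B \<subseteq> ground M"
  obtains B' where "B' \<subseteq> B" "rank M (A \<union> B') = rank M (A \<union> B)"
    "rank M A + rank M B' = rank M (A \<union> B)"
proof -
  have "finite B" using M assms(3) finite_subset by (auto simp: is_matroid_def)
  then have "\<exists>B'\<subseteq>B. rank M (A \<union> B') = rank M (A \<union> B) \<and> rank M A + card B' \<le> rank M (A \<union> B)"
    using assms(3)
  proof (induction B rule: finite_induct)
    case empty
    show ?case by simp
  next
    case (insert x B)
    then obtain B' where B': "B' \<subseteq> B" "rank M (A \<union> B') = rank M (A \<union> B)"
      "rank M A + card B' \<le> rank M (A \<union> B)" by auto
    have le: "rank M (A \<union> B) \<le> rank M (A \<union> insert x B)"
      by (rule rank_mono[OF M]) (use insert.prems assms(2) in auto)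
    show ?case
    proof (cases "rank M (A \<union> insert x B) = rank M (A \<union> B)")
      case True
      then show ?thesis using B' by auto
    next
      case False
      have "card (insert x B') = Suc (card B')"
        using B'(1) insert.hyps finite_subset by (metis card_insert_disjoint subsetD)
      moreover have "rank M (A \<union> insert x B') = rank M (A \<union> insert x B)"
      proof -
        have "A \<union> insert x B' \<subseteq> ground M" "B \<subseteq> ground M"
          using B'(1) insert.prems assms(2) by auto
        moreover have "rank M ((A \<union> B') \<union> B) = rank M (A \<union> B')"
          using B'(1,2) by (simp add: Un_assoc Un_absorb1)
        ultimately have "rank M ((A \<union> insert x B') \<union> B) = rank M (A \<union> insert x B')"
          using rank_Un_spanned[OF M, of "A \<union> B'" "A \<union> insert x B'" B] by blast
        moreover have "(A \<union> insert x B') \<union> B = A \<union> insert x B" using B'(1) by auto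
        ultimately show ?thesis by simp
      qed
      ultimately show ?thesis using B' False le by (intro exI[of _ "insert x B'"]) auto
    qed
  qed
  then obtain B' where B': "B' \<subseteq> B" "rank M (A \<union> B') = rank M (A \<union> B)"
    "rank M A + card B' \<le> rank M (A \<union> B)" by blast
  have "B' \<subseteq> ground M" using B'(1) assms(3) by blast
  then have "rank M A + rank M B' = rank M (A \<union> B)"
    using rank_Un_le[OF M assms(2), of B'] rank_le_card[OF M, of B'] B'(2,3) by linarith
  with B' show thesis using that by blast
qed

section \<open>Contractions and relabellings\<close>

lemma is_matroid_contraction:
  assumes M: "is_matroid M" and C: "C \<subseteq> ground M"
  shows "is_matroid (contraction M C)"
proof -
  have "rank M (X \<union> C) - rank M C \<le> card X" if "X \<subseteq> ground M - C" for X
    using rank_Un_le[OF M, of X C] rank_le_card[OF M, of X] that C by fastforce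
  moreover have "rank M (X \<union> C) - rank M C \<le> rank M (Y \<union> C) - rank M C"
    if "X \<subseteq> Y" "Y \<subseteq> ground M - C" for X Y
    by (intro diff_le_mono rank_mono[OF M]) (use that C in auto)
  moreover have "rank M (X \<union> Y \<union> C) - rank M C + (rank M (X \<inter> Y \<union> C) - rank M C)
      \<le> rank M (X \<union> C) - rank M C + (rank M (Y \<union> C) - rank M C)"
    if "X \<subseteq> ground M - C" "Y \<subseteq> ground M - C" for X Y
  proof -
    have "rank M ((X \<union> C) \<union> (Y \<union> C)) + rank M ((X \<union> C) \<inter> (Y \<union> C))
        \<le> rank M (X \<union> C) + rank M (Y \<union> C)"
      by (rule rank_submodular[OF M]) (use that C in auto)
    moreover have "(X \<union> C) \<union> (Y \<union> C) = X \<union> Y \<union> C" "(X \<union> C) \<inter> (Y \<union> C) = X \<inter> Y \<union> C"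
      by auto
    moreover have "rank M C \<le> rank M (D \<union> C)" if "D \<subseteq> ground M" for D
      by (rule rank_mono[OF M]) (use that C in auto)
    from this[of X] this[of Y] this[of "X \<union> Y"] this[of "X \<inter> Y"]
    have "rank M C \<le> rank M (X \<union> C)" "rank M C \<le> rank M (Y \<union> C)"
      "rank M C \<le> rank M (X \<union> Y \<union> C)" "rank M C \<le> rank M (X \<inter> Y \<union> C)"
      using that by auto
    ultimately show ?thesis by simp
  qed
  moreover have "finite (ground M - C)" using M by (simp add: is_matroid_def)
  ultimately show ?thesis by (simp add: is_matroid_def contraction_def)
qed

lemma rank_relabel_image:
  assumes "inj_on f (ground M)" "X \<subseteq> ground M"
  shows "rank (relabel f M) (f ` X) = rank M X"
proof -
  have "{e \<in> ground M. f e \<in> f ` X} = X" using assms by (auto simp: inj_on_def)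
  then show ?thesis by (simp add: relabel_def)
qed

lemma is_matroid_relabel:
  assumes M: "is_matroid M" and inj: "inj_on f (ground M)"
  shows "is_matroid (relabel f M)"
proof -
  let ?p = "\<lambda>X. {e \<in> ground M. f e \<in> X}"
  have "rank M (?p X) \<le> card X" if "X \<subseteq> f ` ground M" for X
  proof -
    have "f ` ?p X = X" using that by auto
    moreover have "inj_on f (?p X)" using inj by (rule inj_on_subset) auto
    ultimately have "card X = card (?p X)" using card_image by fastforce
    then show ?thesis using rank_le_card[OF M, of "?p X"] by auto
  qed
  moreover have "rank M (?p X) \<le> rank M (?p Y)" if "X \<subseteq> Y" for X Y
    by (rule rank_mono[OF M]) (use that in auto)
  moreover have "rank M (?p (X \<union> Y)) + rank M (?p (X \<inter> Y)) \<le> rank M (?p X) + rank M (?p Y)"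
    for X Y
  proof -
    have "rank M (?p X \<union> ?p Y) + rank M (?p X \<inter> ?p Y) \<le> rank M (?p X) + rank M (?p Y)"
      by (rule rank_submodular[OF M]) auto
    moreover have "?p X \<union> ?p Y = ?p (X \<union> Y)" "?p X \<inter> ?p Y = ?p (X \<inter> Y)" by auto
    ultimately show ?thesis by simp
  qed
  moreover have "finite (f ` ground M)" using M by (simp add: is_matroid_def)
  ultimately show ?thesis unfolding is_matroid_def relabel_def fst_conv snd_conv by blast
qed

section \<open>Layers of a tensor product with a rank-two uniform matroid\<close>

lemma rank_tensor_product:
  assumes "is_tensor_product M U N" "X \<subseteq> ground M" "Y \<subseteq> ground U"
  shows "rank N (X \<times> Y) = rank M X * rank U Y"
  using assms by (simp add: is_tensor_product_def)

lemma rank_layer: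
  assumes "is_tensor_product M U N" "is_uniform 2 n U" "p \<in> ground U" "X \<subseteq> ground M"
  shows "rank N (X \<times> {p}) = rank M X"
  using rank_tensor_product[OF assms(1,4), of "{p}"] assms(2,3) by (simp add: is_uniform_def)

text \<open>
  The two full layers together form \<open>ground M \<times> {p, q}\<close>, whose rank is twice that of \<open>M\<close>, so they
  are skew; skewness passes to subsets, one side at a time.
\<close>

lemma rank_two_layers:
  assumes T: "is_tensor_product M U N" and U: "is_uniform 2 n U"
    and pq: "p \<in> ground U" "q \<in> ground U" "p \<noteq> q"
    and X: "X \<subseteq> ground M" and Y: "Y \<subseteq> ground M"
  shows "rank N (X \<times> {p} \<union> Y \<times> {q}) = rank M X + rank M Y"
proof -
  let ?P = "ground M \<times> {p}" and ?Q = "ground M \<times> {q}"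
  note layer = rank_layer[OF T U]
  have N: "is_matroid N" and g: "ground N = ground M \<times> ground U"
    using T by (auto simp: is_tensor_product_def)
  have sub: "Z \<times> {s} \<subseteq> ground N" if "Z \<subseteq> ground M" "s \<in> ground U" for Z s
    using that g by auto
  have "rank N (ground M \<times> {p, q}) = rank M (ground M) * 2"
    using rank_tensor_product[OF T, of "ground M" "{p, q}"] U pq by (simp add: is_uniform_def)
  moreover have "ground M \<times> {p, q} = ?P \<union> ?Q" by auto
  ultimately have full: "rank N (?P \<union> ?Q) = rank N ?P + rank N ?Q"
    using layer pq by simp
  have half: "rank N (?P \<union> Y \<times> {q}) = rank N ?P + rank N (Y \<times> {q})"
    by (rule skew_subset[OF N _ _ full]) (use sub pq Y in auto)
  have "rank N (Y \<times> {q} \<union> X \<times> {p}) = rank N (Y \<times> {q}) + rank N (X \<times> {p})"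
    by (rule skew_subset[OF N, of "Y \<times> {q}" ?P])
      (use half sub[OF Y] sub[OF subset_refl] pq X in \<open>auto simp: Un_commute\<close>)
  then show ?thesis using layer pq X Y by (simp add: Un_commute)
qed

text \<open>
  Since \<open>X \<times> {p, q}\<close> and \<open>X \<times> {p, q, s}\<close> have the same rank, the part over \<open>s\<close> of any set containing
  \<open>X \<times> {p, q}\<close> may be enlarged by \<open>X\<close> without raising the rank.
\<close>

lemma two_layers_span_third:
  assumes T: "is_tensor_product M U N" and U: "is_uniform 2 n U"
    and pqs: "p \<in> ground U" "q \<in> ground U" "s \<in> ground U" "p \<noteq> q" "s \<noteq> p" "s \<noteq> q"
    and X: "X \<subseteq> ground M" and W: "X \<times> {p} \<union> X \<times> {q} \<subseteq> W" "W \<subseteq> ground N"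
  shows "rank N (W \<union> X \<times> {s}) = rank N W"
proof (rule rank_Un_spanned[OF _ W])
  show "is_matroid N" "X \<times> {s} \<subseteq> ground N"
    using T X pqs by (auto simp: is_tensor_product_def)
  have "rank N (X \<times> {p, q, s}) = rank M X * 2"
    using rank_tensor_product[OF T X, of "{p, q, s}"] U pqs by (simp add: is_uniform_def)
  moreover have "X \<times> {p, q, s} = X \<times> {p} \<union> X \<times> {q} \<union> X \<times> {s}" by auto
  ultimately show "rank N (X \<times> {p} \<union> X \<times> {q} \<union> X \<times> {s}) = rank N (X \<times> {p} \<union> X \<times> {q})"
    using rank_two_layers[OF T U pqs(1,2,4) X X] by simp
qed

text \<open>
  Here \<open>X \<times> {p} \<union> X \<times> {q}\<close> spans \<open>X \<times> {s}\<close>, while \<open>X \<times> {p} \<union> (X \<union> Y) \<times> {s}\<close> spans \<open>X \<times> {q}\<close>;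
  so the layer over \<open>q\<close> can be moved onto \<open>s\<close>.
\<close>

lemma rank_three_layers:
  assumes T: "is_tensor_product M U N" and U: "is_uniform 2 n U"
    and pqs: "p \<in> ground U" "q \<in> ground U" "s \<in> ground U" "p \<noteq> q" "s \<noteq> p" "s \<noteq> q"
    and X: "X \<subseteq> Z" and Z: "Z \<subseteq> ground M" and Y: "Y \<subseteq> ground M"
  shows "rank N (Z \<times> {p} \<union> X \<times> {q} \<union> Y \<times> {s}) = rank M Z + rank M (X \<union> Y)"
proof -
  have XM: "X \<subseteq> ground M" using X Z by auto
  have g: "ground N = ground M \<times> ground U"
    using T by (simp add: is_tensor_product_def)
  have "rank N (Z \<times> {p} \<union> X \<times> {q} \<union> Y \<times> {s})
      = rank N ((Z \<times> {p} \<union> X \<times> {q} \<union> Y \<times> {s}) \<union> X \<times> {s})"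
    by (rule two_layers_span_third[OF T U pqs XM, symmetric]) (use X Z Y XM pqs g in auto)
  also have "(Z \<times> {p} \<union> X \<times> {q} \<union> Y \<times> {s}) \<union> X \<times> {s}
      = (Z \<times> {p} \<union> (X \<union> Y) \<times> {s}) \<union> X \<times> {q}" by auto
  also have "rank N \<dots> = rank N (Z \<times> {p} \<union> (X \<union> Y) \<times> {s})"
    by (rule two_layers_span_third[OF T U, of p s q]) (use X Z Y XM pqs g in auto)
  also have "\<dots> = rank M Z + rank M (X \<union> Y)"
    by (rule rank_two_layers[OF T U]) (use XM Y Z pqs in auto)
  finally show ?thesis .
qed

section \<open>The one-step extension\<close>

theorem theorem5p1:
  fixes S1 :: "'a set" and r1 :: "'a set \<Rightarrow> nat"
    and S2 :: "'b set" and r2 :: "'b set \<Rightarrow> nat"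
    and r :: "('a \<times> 'b) set \<Rightarrow> nat"
    and A B :: "'a set"
  assumes "is_matroid (S1, r1)"
    and "is_uniform 2 3 (S2, r2)"
    and "is_tensor_product (S1, r1) (S2, r2) (S1 \<times> S2, r)"
    and "A \<subseteq> S1" and "B \<subseteq> S1"
  shows "\<exists>N'. is_minor N' (S1 \<times> S2, r) \<and>
    (\<exists>u\<in>S2. is_one_step_extension N' (relabel (\<lambda>e. (e, u)) (S1, r1))
               ((\<lambda>e. (e, u)) ` A) ((\<lambda>e. (e, u)) ` B))"
proof -
  let ?M = "(S1, r1)" and ?N = "(S1 \<times> S2, r)"
  note M = assms(1) and U = assms(2) and T = assms(3)
  have N: "is_matroid ?N" using T by (simp add: is_tensor_product_def)
  have "card S2 = 3" using U by (simp add: is_uniform_def)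
  then obtain u v w where S2: "S2 = {u, v, w}" and ne: "u \<noteq> v" "v \<noteq> w" "u \<noteq> w"
    by (auto simp: card_3_iff)
  obtain B' where B': "B' \<subseteq> B" "r1 (A \<union> B') = r1 (A \<union> B)" "r1 A + r1 B' = r1 (A \<union> B)"
    using obtain_relative_basis[OF M, of A B] assms(4,5) by auto
  have B'S: "B' \<subseteq> S1" using B'(1) assms(5) by auto
  note two = rank_two_layers[OF T U] and three = rank_three_layers[OF T U]

  let ?C = "A \<times> {v} \<union> B' \<times> {w}"
  let ?Z = "(B - B') \<times> {w}"
  let ?N' = "contraction ?N ?C"
  let ?f = "\<lambda>e. (e, u)"
  have C: "?C \<subseteq> ground ?N" using assms(4) B'S S2 by auto
  have rC: "r ?C = r1 (A \<union> B)"
    using two[of v w A B'] S2 ne assms(4) B'S B'(3) by simp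
  have rank': "rank ?N' X = r (X \<union> ?C) - r1 (A \<union> B)" for X
    by (simp add: contraction_def rC)

  have skew: "r (X \<times> {u} \<union> ?C) = r1 X + r1 (A \<union> B)" if "X \<subseteq> S1" for X
  proof -
    have layer: "r (Y \<times> {u}) = r1 Y" if "Y \<subseteq> S1" for Y
      using rank_layer[OF T U, of u Y] that S2 by simp
    have "r (S1 \<times> {u} \<union> ?C) = r1 S1 + r1 (A \<union> B')"
      using three[of u v w A S1 B'] S2 ne assms(4) B'S by (simp add: Un_assoc)
    then have full: "rank ?N (?C \<union> S1 \<times> {u}) = rank ?N ?C + rank ?N (S1 \<times> {u})"
      using rC B'(2) layer by (simp add: Un_commute)
    have "rank ?N (?C \<union> X \<times> {u}) = rank ?N ?C + rank ?N (X \<times> {u})"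
      by (rule skew_subset[OF N C _ full]) (use that S2 in auto)
    then show ?thesis using rC layer[OF that] by (simp add: Un_commute)
  qed
  have copy: "rank ?N' (X \<times> {u}) = r1 X" if "X \<subseteq> S1" for X
    using rank' skew[OF that] by simp

  have ZC: "?Z \<union> ?C = A \<times> {v} \<union> B \<times> {w}" using B'(1) by auto
  have AZ: "rank ?N' (A \<times> {u} \<union> ?Z) = r1 A"
    using rank'[of "A \<times> {u} \<union> ?Z"] three[of u v w A A B] S2 ne assms(4,5) ZC
    by (simp add: Un_assoc)
  (* The layer moved is the one contained in the layer over u: above it is A over v,
     here it is B over w, so v and w change roles. *)
  have BZ: "rank ?N' (B \<times> {u} \<union> ?Z) = r1 B"
    using rank'[of "B \<times> {u} \<union> ?Z"] three[of u w v B B A] S2 ne assms(4,5) ZC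
    by (simp add: Un_assoc Un_commute[of "B \<times> {w}"] Un_commute[of B A])
  have Z: "int (rank ?N' ?Z) = int (r1 A) + int (r1 B) - int (r1 (A \<union> B))"
    using rank'[of ?Z] two[of v w A B] S2 ne assms(4,5) ZC rank_Un_le[OF M, of A B]
    by simp

  have f: "?f ` X = X \<times> {u}" for X :: "'a set" by auto
  have inj: "inj_on ?f (ground ?M)" by (auto simp: inj_on_def)
  have relabel: "rank (relabel ?f ?M) (X \<times> {u}) = r1 X" if "X \<subseteq> S1" for X
    using rank_relabel_image[OF inj, of X] that by (simp add: f)
  have g: "ground (relabel ?f ?M) = S1 \<times> {u}" by (simp add: relabel_def f)
  have agree: "rank ?N' Y = rank (relabel ?f ?M) Y" if "Y \<subseteq> S1 \<times> {u}" for Y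
  proof -
    have "Y = (fst ` Y) \<times> {u}" "fst ` Y \<subseteq> S1" using that by force+
    then show ?thesis using copy[of "fst ` Y"] relabel[of "fst ` Y"] by simp
  qed
  have sub: "S1 \<times> {u} \<subseteq> ground ?N'" "?Z \<subseteq> ground ?N'"
    using assms(5) S2 ne by (auto simp: contraction_def)
  have "is_one_step_extension ?N' (relabel ?f ?M) (?f ` A) (?f ` B)"
    unfolding is_one_step_extension_def f g
  proof (intro conjI exI[of _ ?Z])
    show "is_matroid (relabel ?f ?M)" by (rule is_matroid_relabel[OF M inj])
    show "is_matroid ?N'" by (rule is_matroid_contraction[OF N C])
    show "A \<times> {u} \<subseteq> S1 \<times> {u}" "B \<times> {u} \<subseteq> S1 \<times> {u}" using assms(4,5) by auto
    show "\<forall>X. X \<subseteq> S1 \<times> {u} \<longrightarrow> rank ?N' X = rank (relabel ?f ?M) X"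
      using agree by blast
    show "rank ?N' (A \<times> {u} \<union> ?Z) = rank (relabel ?f ?M) (A \<times> {u})"
      using AZ relabel[OF assms(4)] by (rule trans[OF _ sym])
    show "rank ?N' (B \<times> {u} \<union> ?Z) = rank (relabel ?f ?M) (B \<times> {u})"
      using BZ relabel[OF assms(5)] by (rule trans[OF _ sym])
    have "A \<times> {u} \<union> B \<times> {u} = (A \<union> B) \<times> {u}" by auto
    then show "int (rank ?N' ?Z) = int (rank (relabel ?f ?M) (A \<times> {u}))
        + int (rank (relabel ?f ?M) (B \<times> {u}))
        - int (rank (relabel ?f ?M) (A \<times> {u} \<union> B \<times> {u}))"
      using Z relabel[OF assms(4)] relabel[OF assms(5)] relabel[of "A \<union> B"] assms(4,5)
      by (simp only: Un_least)
  qed (rule sub)+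
  moreover have "is_minor ?N' ?N" using is_minor.contract[OF is_minor.refl C] .
  ultimately show ?thesis using S2 by blast
qed

end
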